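(* Let $p$ be a prime and $m \ge 0$ an integer. The algebra $C_m$ is commutative, all of its prime ideals are maximal, and $\operatorname{Spec}(C_m)$ is homeomorphic to the space $\mathbb{Z}_p$ of $p$-adic integers equipped with the $p$-adic topology.
   Context: Let $A = \mathbb{Z}/p^{m+1}$. For an integer $k \ge 1$, let $\partial_t^{[k]} \in \operatorname{End}_A(A[t])$ be the $A$-linear operator with $\partial_t^{[k]}(t^a) = \binom{a}{k} t^{a-k}$ for all integers $a \ge 0$ (so it is $0$ when $a<k$), and let $t^k$ also denote the operator of multiplication by $t^k$. Then $C_m$ is the $A$-subalgebra of $\operatorname{End}_A(A[t])$ generated by the operators $-\partial_t^{[p^i]} t^{p^i}$ (multiply by $t^{p^i}$, then apply $\partial_t^{[p^i]}$, then negate) for $i = 0, 1, 2, \dots$. It is the ring of $A$-linear differential operators (in Grothendieck's sense) on $A[t]$ that are homogeneous of degree $0$ for the grading $\deg t = 1$. *)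

theory Defs
  imports
    "HOL-Number_Theory.Residues"
    "HOL-Algebra.UnivPoly"
    "HOL-Algebra.Subrings"
    "HOL-Analysis.Abstract_Topology"
begin

section \<open>Algebras of linear endomorphisms\<close>

(* Endomorphisms are extensional functions, i.e. undefined outside carrier M, so that HOL equality
   is equality of endomorphisms.  The product f g is "first g, then f". *)
definition module_End ::
    "('a, 'r) ring_scheme \<Rightarrow> ('a, 'b, 'm) module_scheme \<Rightarrow> ('a, 'b \<Rightarrow> 'b) module" where
  "module_End A M =
     \<lparr>carrier = {f \<in> carrier M \<rightarrow>\<^sub>E carrier M.
         (\<forall>x\<in>carrier M. \<forall>y\<in>carrier M. f (x \<oplus>\<^bsub>M\<^esub> y) = f x \<oplus>\<^bsub>M\<^esub> f y) \<and>
         (\<forall>a\<in>carrier A. \<forall>x\<in>carrier M. f (a \<odot>\<^bsub>M\<^esub> x) = a \<odot>\<^bsub>M\<^esub> f x)},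
      monoid.mult = compose (carrier M),
      monoid.one = (\<lambda>x\<in>carrier M. x),
      ring.zero = (\<lambda>x\<in>carrier M. \<zero>\<^bsub>M\<^esub>),
      ring.add = (\<lambda>f g. \<lambda>x\<in>carrier M. f x \<oplus>\<^bsub>M\<^esub> g x),
      module.smult = (\<lambda>a f. \<lambda>x\<in>carrier M. a \<odot>\<^bsub>M\<^esub> f x)\<rparr>"

(* The locale "algebra" of the library is for commutative algebras only, and its "subalgebra" is
   about embedded scalars; neither applies to the noncommutative algebra module_End A M. *)
definition subalgebra_generated ::
    "('a, 'r) ring_scheme \<Rightarrow> ('a, 'b, 'm) module_scheme \<Rightarrow> 'b set \<Rightarrow> 'b set" where
  "subalgebra_generated A E S =
     \<Inter>{B. subring B E \<and> (\<forall>a\<in>carrier A. \<forall>x\<in>B. a \<odot>\<^bsub>E\<^esub> x \<in> B) \<and> S \<subseteq> B}"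

lemma (in module) module_End_ring: "ring (module_End R M)"
proof -
  let ?E = "module_End R M"
  have app: "(f \<oplus>\<^bsub>?E\<^esub> g) x = f x \<oplus>\<^bsub>M\<^esub> g x" "(f \<otimes>\<^bsub>?E\<^esub> g) x = f (g x)"
    "\<zero>\<^bsub>?E\<^esub> x = \<zero>\<^bsub>M\<^esub>" "\<one>\<^bsub>?E\<^esub> x = x" if "x \<in> carrier M" for f g x
    using that by (simp_all add: module_End_def compose_def)
  have mem: "f x \<in> carrier M" if "f \<in> carrier ?E" "x \<in> carrier M" for f x
    using that by (auto simp: module_End_def)
  have lin: "f (x \<oplus>\<^bsub>M\<^esub> y) = f x \<oplus>\<^bsub>M\<^esub> f y" if "f \<in> carrier ?E" "x \<in> carrier M" "y \<in> carrier M" for f x y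
    using that by (simp add: module_End_def)
  have scal: "f (a \<odot>\<^bsub>M\<^esub> x) = a \<odot>\<^bsub>M\<^esub> f x" if "f \<in> carrier ?E" "a \<in> carrier R" "x \<in> carrier M" for f a x
    using that by (simp add: module_End_def)
  have I: "f \<in> carrier ?E"
    if "f \<in> extensional (carrier M)" "\<And>x. x \<in> carrier M \<Longrightarrow> f x \<in> carrier M"
      "\<And>x y. x \<in> carrier M \<Longrightarrow> y \<in> carrier M \<Longrightarrow> f (x \<oplus>\<^bsub>M\<^esub> y) = f x \<oplus>\<^bsub>M\<^esub> f y"
      "\<And>a x. a \<in> carrier R \<Longrightarrow> x \<in> carrier M \<Longrightarrow> f (a \<odot>\<^bsub>M\<^esub> x) = a \<odot>\<^bsub>M\<^esub> f x" for f
    using that by (simp add: module_End_def PiE_def)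
  have ext: "f = g" if "f \<in> carrier ?E" "g \<in> carrier ?E" "\<And>x. x \<in> carrier M \<Longrightarrow> f x = g x" for f g
    by (rule extensionalityI[of _ "carrier M"]) (use that in \<open>auto simp: module_End_def PiE_def\<close>)
  have add: "f \<oplus>\<^bsub>?E\<^esub> g \<in> carrier ?E" if "f \<in> carrier ?E" "g \<in> carrier ?E" for f g
  proof (rule I)
    show "f \<oplus>\<^bsub>?E\<^esub> g \<in> extensional (carrier M)" by (simp add: module_End_def)
  qed (use that in \<open>simp_all add: app mem lin scal smult_r_distr M.a_ac\<close>)
  have mult: "f \<otimes>\<^bsub>?E\<^esub> g \<in> carrier ?E" if "f \<in> carrier ?E" "g \<in> carrier ?E" for f g
  proof (rule I)
    show "f \<otimes>\<^bsub>?E\<^esub> g \<in> extensional (carrier M)" by (simp add: module_End_def)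
  qed (use that in \<open>simp_all add: app mem lin scal\<close>)
  have zero: "\<zero>\<^bsub>?E\<^esub> \<in> carrier ?E"
  proof (rule I)
    show "\<zero>\<^bsub>?E\<^esub> \<in> extensional (carrier M)" by (simp add: module_End_def)
  qed (simp_all add: app smult_r_null)
  have one: "\<one>\<^bsub>?E\<^esub> \<in> carrier ?E"
  proof (rule I)
    show "\<one>\<^bsub>?E\<^esub> \<in> extensional (carrier M)" by (simp add: module_End_def)
  qed (simp_all add: app)
  have neg: "\<exists>g\<in>carrier ?E. g \<oplus>\<^bsub>?E\<^esub> f = \<zero>\<^bsub>?E\<^esub>" if f: "f \<in> carrier ?E" for f
  proof
    show g: "(\<lambda>x\<in>carrier M. \<ominus>\<^bsub>M\<^esub> f x) \<in> carrier ?E"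
      by (rule I) (use f in \<open>simp_all add: mem lin scal M.minus_add smult_r_minus\<close>)
    show "(\<lambda>x\<in>carrier M. \<ominus>\<^bsub>M\<^esub> f x) \<oplus>\<^bsub>?E\<^esub> f = \<zero>\<^bsub>?E\<^esub>"
      by (rule ext) (use f g in \<open>simp_all add: add zero app mem M.l_neg\<close>)
  qed
  show ?thesis
  proof (rule ringI)
    show "abelian_group ?E"
      by (rule abelian_groupI; (rule ext)?) (simp_all add: add zero neg app mem M.a_ac)
    show "monoid ?E"
      by (rule monoidI; (rule ext)?) (simp_all add: mult one app mem)
  qed (rule ext; simp add: add mult app mem lin)+
qed

section \<open>Divided power differential operators\<close>

(* The linear extension of t^a |-> (a choose k) t^(a-k).  The truncated subtraction is harmless:
   the binomial coefficient vanishes for a < k. *)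
definition hasse_deriv :: "('a, 'r) ring_scheme \<Rightarrow> nat \<Rightarrow> (nat \<Rightarrow> 'a) \<Rightarrow> nat \<Rightarrow> 'a" where
  "hasse_deriv R k = (\<lambda>f\<in>carrier (UP R).
     \<Oplus>\<^bsub>UP R\<^esub>a\<in>{..deg R f}.
       coeff (UP R) f a \<odot>\<^bsub>UP R\<^esub> ([(a choose k)] \<cdot>\<^bsub>UP R\<^esub> monom (UP R) \<one>\<^bsub>R\<^esub> (a - k)))"

definition mult_by_monom :: "('a, 'r) ring_scheme \<Rightarrow> nat \<Rightarrow> (nat \<Rightarrow> 'a) \<Rightarrow> nat \<Rightarrow> 'a" where
  "mult_by_monom R k = (\<lambda>f\<in>carrier (UP R). monom (UP R) \<one>\<^bsub>R\<^esub> k \<otimes>\<^bsub>UP R\<^esub> f)"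

context UP_cring
begin

lemma coeff_add_pow:
  assumes "f \<in> carrier P"
  shows "coeff P ([(k::nat)] \<cdot>\<^bsub>P\<^esub> f) n = [k] \<cdot> coeff P f n"
proof (induction k)
  case (Suc k)
  have "coeff P ([(Suc k)] \<cdot>\<^bsub>P\<^esub> f) n = coeff P ([k] \<cdot>\<^bsub>P\<^esub> f \<oplus>\<^bsub>P\<^esub> f) n" by simp
  then show ?case using assms Suc by simp
qed simp

lemma coeff_hasse_deriv:
  assumes f: "f \<in> carrier P"
  shows "coeff P (hasse_deriv R k f) n = [((n + k) choose k)] \<cdot> coeff P f (n + k)"
proof -
  let ?g = "\<lambda>a. coeff P f a \<odot>\<^bsub>P\<^esub> ([(a choose k)] \<cdot>\<^bsub>P\<^esub> monom P \<one> (a - k))"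
  let ?c = "[((n + k) choose k)] \<cdot> coeff P f (n + k)"
  have g: "?g \<in> {..deg R f} \<rightarrow> carrier P"
    using f by auto
  have c: "coeff P (?g a) n = (if n + k = a then ?c else \<zero>)" for a
  proof (cases "a < k")
    case True
    then show ?thesis using f by (auto simp: coeff_add_pow binomial_eq_0)
  next
    case False
    then have "a - k = n \<longleftrightarrow> n + k = a" by auto
    then show ?thesis using f by (auto simp: coeff_add_pow R.add_pow_rdistr)
  qed
  have "coeff P (hasse_deriv R k f) n = (\<Oplus>a\<in>{..deg R f}. coeff P (?g a) n)"
    using f g by (simp add: hasse_deriv_def coeff_finsum flip: P_def)
  also have "\<dots> = (\<Oplus>a\<in>{..deg R f}. if n + k = a then ?c else \<zero>)"
    by (simp only: c)
  also have "\<dots> = ?c"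
  proof (cases "n + k \<le> deg R f")
    case True
    then show ?thesis
      using f R.add.finprod_singleton[of "n + k" "{..deg R f}" "\<lambda>_. ?c"] by simp
  next
    case False
    then have "(\<Oplus>a\<in>{..deg R f}. if n + k = a then ?c else \<zero>) = (\<Oplus>a\<in>{..deg R f}. \<zero>)"
      by (intro R.finsum_cong') auto
    then show ?thesis using False f by (simp add: deg_aboveD)
  qed
  finally show ?thesis .
qed

lemma hasse_deriv_closed: "f \<in> carrier P \<Longrightarrow> hasse_deriv R k f \<in> carrier P"
  unfolding hasse_deriv_def P_def[symmetric] by (auto intro!: P.finsum_closed)

lemma hasse_deriv_monom:
  "hasse_deriv R k (monom P \<one> a) = [(a choose k)] \<cdot>\<^bsub>P\<^esub> monom P \<one> (a - k)"
proof (cases "a < k")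
  case True
  then show ?thesis
    by (intro up_eqI) (auto simp: coeff_hasse_deriv coeff_add_pow hasse_deriv_closed binomial_eq_0)
next
  case False
  then show ?thesis
    by (intro up_eqI) (auto simp: coeff_hasse_deriv coeff_add_pow hasse_deriv_closed)
qed

lemma hasse_deriv_in_End: "hasse_deriv R k \<in> carrier (module_End R P)"
proof -
  have "hasse_deriv R k \<in> extensional (carrier P)"
    by (simp add: hasse_deriv_def P_def)
  moreover have "hasse_deriv R k (f \<oplus>\<^bsub>P\<^esub> g) = hasse_deriv R k f \<oplus>\<^bsub>P\<^esub> hasse_deriv R k g"
    if "f \<in> carrier P" "g \<in> carrier P" for f g
    using that by (intro up_eqI)
      (auto simp: coeff_hasse_deriv hasse_deriv_closed R.add.nat_pow_distrib)
  moreover have "hasse_deriv R k (a \<odot>\<^bsub>P\<^esub> f) = a \<odot>\<^bsub>P\<^esub> hasse_deriv R k f"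
    if "a \<in> carrier R" "f \<in> carrier P" for a f
    using that by (intro up_eqI)
      (auto simp: coeff_hasse_deriv hasse_deriv_closed R.add_pow_rdistr)
  ultimately show ?thesis
    by (auto simp: module_End_def PiE_def hasse_deriv_closed)
qed

lemma mult_by_monom_in_End: "mult_by_monom R k \<in> carrier (module_End R P)"
  unfolding module_End_def mult_by_monom_def P_def[symmetric]
  by (auto simp: P.r_distr P.m_comm[of "monom P \<one> k"] smult_assoc2
      intro: P.l_distr)

end

section \<open>The algebra $C_m$\<close>

definition C_alg :: "nat \<Rightarrow> nat \<Rightarrow> (int, (nat \<Rightarrow> int) \<Rightarrow> nat \<Rightarrow> int) module" where
  "C_alg p m =
     (let A = residue_ring (int (p ^ (m + 1)));
          E = module_End A (UP A)
      in E\<lparr>carrier := subalgebra_generated A E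
            (range (\<lambda>i. \<ominus>\<^bsub>E\<^esub> (hasse_deriv A (p ^ i) \<otimes>\<^bsub>E\<^esub> mult_by_monom A (p ^ i))))\<rparr>)"

section \<open>The prime spectrum\<close>

(* The Zariski topology.  Letting S range over all subsets rather than over ideals makes no
   difference, as V(S) is unchanged when S is replaced by the ideal it generates. *)
definition Spec_topology :: "('a, 'm) ring_scheme \<Rightarrow> 'a set topology" where
  "Spec_topology R =
     topology (\<lambda>U. \<exists>S\<subseteq>carrier R. U = {P. primeideal P R} - {P. primeideal P R \<and> S \<subseteq> P})"

lemma openin_Spec_topology:
  "openin (Spec_topology R) U \<longleftrightarrow>
     (\<exists>S\<subseteq>carrier R. U = {P. primeideal P R} - {P. primeideal P R \<and> S \<subseteq> P})"
proof -
  let ?D = "\<lambda>S. {P. primeideal P R} - {P. primeideal P R \<and> S \<subseteq> P}"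
  have "istopology (\<lambda>U. \<exists>S\<subseteq>carrier R. U = ?D S)"
    unfolding istopology_def
  proof (intro conjI allI impI)
    fix U V assume "\<exists>S\<subseteq>carrier R. U = ?D S" "\<exists>S\<subseteq>carrier R. V = ?D S"
    then obtain S T where S: "S \<subseteq> carrier R" "U = ?D S" and T: "T \<subseteq> carrier R" "V = ?D T"
      by blast
    let ?ST = "{s \<otimes>\<^bsub>R\<^esub> t | s t. s \<in> S \<and> t \<in> T} \<inter> carrier R"
    have ST: "?ST \<subseteq> P \<longleftrightarrow> S \<subseteq> P \<or> T \<subseteq> P" if "primeideal P R" for P
    proof -
      interpret primeideal P R by (fact that)
      show ?thesis
      proof
        assume *: "?ST \<subseteq> P"
        show "S \<subseteq> P \<or> T \<subseteq> P"
        proof (rule ccontr)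
          assume "\<not> (S \<subseteq> P \<or> T \<subseteq> P)"
          then obtain s t where st: "s \<in> S" "s \<notin> P" "t \<in> T" "t \<notin> P" by blast
          then have "s \<in> carrier R" "t \<in> carrier R" using S T by auto
          moreover from this have "s \<otimes>\<^bsub>R\<^esub> t \<in> P" using * st by auto
          ultimately show False using I_prime st by blast
        qed
      next
        assume "S \<subseteq> P \<or> T \<subseteq> P"
        then show "?ST \<subseteq> P" using S T I_l_closed I_r_closed by blast
      qed
    qed
    have "P \<in> U \<inter> V \<longleftrightarrow> P \<in> ?D ?ST" for P
      unfolding S(2) T(2) Diff_iff Int_iff mem_Collect_eq using ST[of P] by argo
    then have "U \<inter> V = ?D ?ST" by blast
    then show "\<exists>S\<subseteq>carrier R. U \<inter> V = ?D S" by blast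
  next
    fix \<U> assume "\<forall>U\<in>\<U>. \<exists>S\<subseteq>carrier R. U = ?D S"
    then have "\<exists>S. \<forall>U\<in>\<U>. S U \<subseteq> carrier R \<and> U = ?D (S U)"
      by (intro bchoice) blast
    then obtain S where "\<forall>U\<in>\<U>. S U \<subseteq> carrier R \<and> U = ?D (S U)" by (rule exE)
    then have S: "S U \<subseteq> carrier R" "?D (S U) = U" if "U \<in> \<U>" for U
      using that by (blast, metis)
    have "\<Union>\<U> = (\<Union>U\<in>\<U>. ?D (S U))" using SUP_cong[OF refl S(2), of \<U>] by simp
    also have "\<dots> = ?D (\<Union>U\<in>\<U>. S U)" by blast
    finally have "\<Union>\<U> = ?D (\<Union>U\<in>\<U>. S U)" .
    moreover have "(\<Union>U\<in>\<U>. S U) \<subseteq> carrier R" using S(1) by blast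
    ultimately show "\<exists>S\<subseteq>carrier R. \<Union>\<U> = ?D S" by blast
  qed
  then show ?thesis
    unfolding Spec_topology_def by (simp add: topology_inverse')
qed

lemma topspace_Spec_topology: "topspace (Spec_topology R) = {P. primeideal P R}"
proof
  show "topspace (Spec_topology R) \<subseteq> {P. primeideal P R}"
    unfolding topspace_def openin_Spec_topology by blast
  have "{P. primeideal P R} = {P. primeideal P R} - {P. primeideal P R \<and> carrier R \<subseteq> P}"
  proof -
    have "\<not> carrier R \<subseteq> P" if "primeideal P R" for P
    proof -
      interpret primeideal P R by (fact that)
      show ?thesis using I_notcarr a_subset by blast
    qed
    then show ?thesis by blast
  qed
  then have "openin (Spec_topology R) {P. primeideal P R}"
    unfolding openin_Spec_topology by blast
  then show "{P. primeideal P R} \<subseteq> topspace (Spec_topology R)"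
    by (rule openin_subset)
qed

section \<open>The \<open>p\<close>-adic integers\<close>

(* The inverse limit of the rings Z/p^n, n = 0, 1, 2, ..., whose elements are represented by
   residues in {0..<p^n}. *)
definition padic_ints :: "nat \<Rightarrow> (nat \<Rightarrow> int) ring" where
  "padic_ints p =
     \<lparr>carrier = {x. \<forall>n. x n \<in> {0..<int p ^ n} \<and> x (Suc n) mod int p ^ n = x n},
      monoid.mult = (\<lambda>x y n. (x n * y n) mod int p ^ n),
      monoid.one = (\<lambda>n. 1 mod int p ^ n),
      ring.zero = (\<lambda>n. 0),
      ring.add = (\<lambda>x y n. (x n + y n) mod int p ^ n)\<rparr>"

(* Generated by the cosets x + p^n Z_p. *)
definition padic_topology :: "nat \<Rightarrow> (nat \<Rightarrow> int) topology" where
  "padic_topology p =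
     (let Z = padic_ints p
      in topology_generated_by
           {(PIdl\<^bsub>Z\<^esub> ([(p ^ n)] \<cdot>\<^bsub>Z\<^esub> \<one>\<^bsub>Z\<^esub>)) +>\<^bsub>Z\<^esub> x | n x. x \<in> carrier Z})"

lemma padic_ints_cring:
  assumes "p > 0"
  shows "cring (padic_ints p)"
proof -
  have dvd: "int p ^ n dvd int p ^ Suc n" for n by simp
  have lift: "(a mod int p ^ Suc n) mod int p ^ n = a mod int p ^ n" for a n
    using dvd by (rule mod_mod_cancel)
  have pos: "0 < int p ^ n" for n using assms by simp
  have small: "x n mod int p ^ n = x n" if "x \<in> carrier (padic_ints p)" for x n
    using that by (simp add: padic_ints_def)
  have closed: "(\<lambda>n. f n mod int p ^ n) \<in> carrier (padic_ints p)"
    if "\<And>n. f (Suc n) mod int p ^ n = f n mod int p ^ n" for f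
    using that pos by (simp add: padic_ints_def lift del: power_Suc)
  have compat: "x (Suc n) mod int p ^ n = x n mod int p ^ n" if "x \<in> carrier (padic_ints p)" for x n
    using that by (simp add: padic_ints_def)
  have add: "x \<oplus>\<^bsub>padic_ints p\<^esub> y \<in> carrier (padic_ints p)"
    if "x \<in> carrier (padic_ints p)" "y \<in> carrier (padic_ints p)" for x y
    using closed[of "\<lambda>n. x n + y n"] mod_add_cong[OF compat[OF that(1)] compat[OF that(2)]]
    by (simp add: padic_ints_def)
  have mult: "x \<otimes>\<^bsub>padic_ints p\<^esub> y \<in> carrier (padic_ints p)"
    if "x \<in> carrier (padic_ints p)" "y \<in> carrier (padic_ints p)" for x y
    using closed[of "\<lambda>n. x n * y n"] mod_mult_cong[OF compat[OF that(1)] compat[OF that(2)]]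
    by (simp add: padic_ints_def)
  have one: "\<one>\<^bsub>padic_ints p\<^esub> \<in> carrier (padic_ints p)"
    using closed[of "\<lambda>n. 1"] by (simp add: padic_ints_def)
  have zero: "\<zero>\<^bsub>padic_ints p\<^esub> \<in> carrier (padic_ints p)"
    using pos by (simp add: padic_ints_def)
  have neg: "\<exists>y\<in>carrier (padic_ints p). y \<oplus>\<^bsub>padic_ints p\<^esub> x = \<zero>\<^bsub>padic_ints p\<^esub>"
    if "x \<in> carrier (padic_ints p)" for x
  proof
    show "(\<lambda>n. (- x n) mod int p ^ n) \<in> carrier (padic_ints p)"
      using closed[of "\<lambda>n. - x n"] mod_minus_cong[OF compat[OF that]] by simp
  qed (simp add: padic_ints_def mod_simps)
  have ops: "x \<oplus>\<^bsub>padic_ints p\<^esub> y = (\<lambda>n. (x n + y n) mod int p ^ n)"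
    "x \<otimes>\<^bsub>padic_ints p\<^esub> y = (\<lambda>n. (x n * y n) mod int p ^ n)"
    "\<one>\<^bsub>padic_ints p\<^esub> = (\<lambda>n. 1 mod int p ^ n)" "\<zero>\<^bsub>padic_ints p\<^esub> = (\<lambda>n. 0)" for x y
    by (simp_all add: padic_ints_def)
  show ?thesis
  proof (rule cringI)
    show "abelian_group (padic_ints p)"
      by (rule abelian_groupI; (rule add neg; assumption)?)
         (auto intro: zero[unfolded ops] simp: ops mod_simps small algebra_simps)
    show "comm_monoid (padic_ints p)"
      by (rule comm_monoidI; (rule mult; assumption)?)
         (auto intro: one[unfolded ops] simp: ops mod_simps small algebra_simps)
  qed (auto simp: ops mod_simps algebra_simps)
qed

lemma padic_coset_eq:
  assumes p: "p > 0" and x: "x \<in> carrier (padic_ints p)"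
  shows "(PIdl\<^bsub>padic_ints p\<^esub> ([(p ^ n)] \<cdot>\<^bsub>padic_ints p\<^esub> \<one>\<^bsub>padic_ints p\<^esub>)) +>\<^bsub>padic_ints p\<^esub> x =
    {y \<in> carrier (padic_ints p). y n = x n}"
proof -
  let ?Z = "padic_ints p"
  interpret Z: cring ?Z using p by (rule padic_ints_cring)
  have pos: "0 < int p ^ k" for k using p by simp
  have pow: "[k] \<cdot>\<^bsub>?Z\<^esub> \<one>\<^bsub>?Z\<^esub> = (\<lambda>j. int k mod int p ^ j)" for k :: nat
  proof (induction k)
    case 0
    have "[(0::nat)] \<cdot>\<^bsub>?Z\<^esub> \<one>\<^bsub>?Z\<^esub> = \<zero>\<^bsub>?Z\<^esub>" by simp
    then show ?case by (simp add: padic_ints_def)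
  next
    case (Suc k)
    have "[(Suc k)] \<cdot>\<^bsub>?Z\<^esub> \<one>\<^bsub>?Z\<^esub> = [k] \<cdot>\<^bsub>?Z\<^esub> \<one>\<^bsub>?Z\<^esub> \<oplus>\<^bsub>?Z\<^esub> \<one>\<^bsub>?Z\<^esub>" by simp
    also have "\<dots> = (\<lambda>j. (int k mod int p ^ j + 1 mod int p ^ j) mod int p ^ j)"
      unfolding Suc by (simp add: padic_ints_def)
    finally show ?case by (simp add: mod_add_eq add.commute)
  qed
  have coset: "(PIdl\<^bsub>?Z\<^esub> ([(p ^ n)] \<cdot>\<^bsub>?Z\<^esub> \<one>\<^bsub>?Z\<^esub>)) +>\<^bsub>?Z\<^esub> x =
      {z \<otimes>\<^bsub>?Z\<^esub> ([(p ^ n)] \<cdot>\<^bsub>?Z\<^esub> \<one>\<^bsub>?Z\<^esub>) \<oplus>\<^bsub>?Z\<^esub> x | z. z \<in> carrier ?Z}"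
    by (auto simp: a_r_coset_def' cgenideal_def)
  have eq: "z \<otimes>\<^bsub>?Z\<^esub> ([(p ^ n)] \<cdot>\<^bsub>?Z\<^esub> \<one>\<^bsub>?Z\<^esub>) \<oplus>\<^bsub>?Z\<^esub> x = (\<lambda>j. (z j * int p ^ n + x j) mod int p ^ j)" for z
    unfolding pow by (simp add: padic_ints_def mod_simps)
  have small: "y k mod int p ^ k = y k" if "y \<in> carrier ?Z" for y k
    using that by (simp add: padic_ints_def)
  show ?thesis
  proof (intro equalityI subsetI)
    fix y assume "y \<in> (PIdl\<^bsub>?Z\<^esub> ([(p ^ n)] \<cdot>\<^bsub>?Z\<^esub> \<one>\<^bsub>?Z\<^esub>)) +>\<^bsub>?Z\<^esub> x"
    then obtain z where z: "z \<in> carrier ?Z"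
      "y = z \<otimes>\<^bsub>?Z\<^esub> ([(p ^ n)] \<cdot>\<^bsub>?Z\<^esub> \<one>\<^bsub>?Z\<^esub>) \<oplus>\<^bsub>?Z\<^esub> x"
      unfolding coset by blast
    then have "y \<in> carrier ?Z" using x by simp
    moreover have "y n = x n" using z(2) small[OF x] unfolding eq by simp
    ultimately show "y \<in> {y \<in> carrier ?Z. y n = x n}" by simp
  next
    fix y assume "y \<in> {y \<in> carrier ?Z. y n = x n}"
    then have y: "y \<in> carrier ?Z" "y n = x n" by auto
    define d where "d j = y j - x j" for j
    have d_step: "int p ^ j dvd d (Suc j) - d j" for j
    proof -
      have "int p ^ j dvd v (Suc j) - v j" if "v \<in> carrier ?Z" for v
        using that by (metis (mono_tags, lifting) mod_eq_dvd_iff small padic_ints_def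
          partial_object.simps(1) mem_Collect_eq)
      from dvd_diff[OF this[OF y(1)] this[OF x]] show ?thesis
        by (simp add: d_def algebra_simps)
    qed
    have d_cong: "int p ^ j dvd d (j + i) - d j" for i j
    proof (induction i)
      case (Suc i)
      have "int p ^ j dvd d (Suc (j + i)) - d (j + i)"
        using d_step[of "j + i"] by (rule dvd_trans[rotated]) (simp add: le_imp_power_dvd)
      from dvd_add[OF this Suc] show ?case by simp
    qed simp
    have "\<exists>e. d (n + k) = int p ^ n * e" for k
      using d_cong[of n k] y(2) by (simp add: d_def dvd_def)
    then obtain e where e: "\<And>k. d (n + k) = int p ^ n * e k" by metis
    have e_step: "int p ^ k dvd e (Suc k) - e k" for k
    proof -
      have "int p ^ n * int p ^ k dvd int p ^ n * (e (Suc k) - e k)"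
        using d_step[of "n + k"] e[of k] e[of "Suc k"] by (simp add: power_add right_diff_distrib)
      then show ?thesis using pos[of n] by (metis dvd_mult_cancel_left less_irrefl)
    qed
    define z where "z k = e k mod int p ^ k" for k
    have "z (Suc k) mod int p ^ k = z k" for k
    proof -
      have "z (Suc k) mod int p ^ k = e (Suc k) mod int p ^ k"
        unfolding z_def by (rule mod_mod_cancel) simp
      also have "\<dots> = z k" using e_step[of k] by (simp add: z_def mod_eq_dvd_iff)
      finally show ?thesis .
    qed
    then have z: "z \<in> carrier ?Z" using pos by (simp add: padic_ints_def z_def)
    have "(z k * int p ^ n + x k) mod int p ^ k = y k" for k
    proof -
      have "(z k * int p ^ n + x k) mod int p ^ k = (d (n + k) + x k) mod int p ^ k"
        unfolding e z_def mult.commute[of "int p ^ n"]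
        by (intro mod_add_cong mod_mult_cong) simp_all
      also have "\<dots> = (d k + x k) mod int p ^ k"
        using d_cong[of k n] by (simp add: mod_eq_dvd_iff add.commute)
      also have "\<dots> = y k" using small[OF y(1)] by (simp add: d_def)
      finally show ?thesis .
    qed
    then have "y = z \<otimes>\<^bsub>?Z\<^esub> ([(p ^ n)] \<cdot>\<^bsub>?Z\<^esub> \<one>\<^bsub>?Z\<^esub>) \<oplus>\<^bsub>?Z\<^esub> x" unfolding eq by simp
    with z show "y \<in> (PIdl\<^bsub>?Z\<^esub> ([(p ^ n)] \<cdot>\<^bsub>?Z\<^esub> \<one>\<^bsub>?Z\<^esub>)) +>\<^bsub>?Z\<^esub> x"
      unfolding coset by blast
  qed
qed

end

theory Submission
  imports Defs
begin

text \<open>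
  The generators act diagonally on the monomials: \<open>t\<^sup>a\<close> is multiplied by \<open>- (a + p\<^sup>i choose p\<^sup>i)\<close>. So
  \<open>C\<^sub>m\<close> is a ring of functions \<open>\<phi>\<close> of the exponent \<open>a\<close>, with values modulo \<open>p\<^bsup>m + 1\<^esup>\<close> and pointwise
  operations (\<open>carrier_C\<close>); in particular it is commutative.

  A function with values divisible by \<open>p\<close> is nilpotent, so the prime ideals only depend on the functions
  modulo \<open>p\<close>. There the generators read off the base \<open>p\<close> digits of \<open>a\<close>, by Lucas' theorem
  (\<open>choose_prime_power_cong\<close>). Consequently every \<open>\<phi>\<close> depends modulo \<open>p\<close> only on \<open>a mod p\<^sup>N\<close> for some \<open>N\<close>
  (\<open>binomial_functions_periodic\<close>), and conversely the indicator function of each residue class modulo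
  \<open>p\<^sup>n\<close> occurs modulo \<open>p\<close> (\<open>indicator_in_binomial_functions\<close>). In other words, the reduction of \<open>C\<^sub>m\<close> is the
  ring of locally constant functions from \<open>\<int>\<^sub>p\<close> to the field with \<open>p\<close> elements.

  Prime ideals are maximal, because modulo \<open>p\<close> every function satisfies \<open>\<phi>\<^sup>p = \<phi>\<close>. A prime ideal contains all but
  one of the indicators of the residue classes modulo \<open>p\<^sup>n\<close>; the omitted classes are compatible for
  varying \<open>n\<close> and define a point of \<open>\<int>\<^sub>p\<close>, at which the ideal is the kernel of evaluation
  (\<open>prime_is_point_ideal\<close>). The resulting bijection is a homeomorphism: its continuity in one direction is
  the local constancy of the functions, and in the other the presence of the indicators of cosets.
\<close>

section \<open>Binomial coefficients modulo a prime\<close>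

text \<open>By absorption \<open>j \<cdot> (p\<^sup>i choose j) = p\<^sup>i \<cdot> (p\<^sup>i - 1 choose j - 1)\<close>: if \<open>p\<close> did not divide the
  binomial coefficient, then \<open>p\<^sup>i\<close> would divide the smaller positive number \<open>j\<close>.\<close>

lemma prime_dvd_choose_prime_power:
  fixes p :: nat
  assumes "prime p" "0 < j" "j < p ^ i"
  shows "p dvd (p ^ i choose j)"
proof (rule ccontr)
  assume "\<not> p dvd (p ^ i choose j)"
  then have "coprime (p ^ i) (p ^ i choose j)"
    using assms(1) by (simp add: prime_imp_coprime)
  moreover have "p ^ i dvd j * (p ^ i choose j)"
    using assms(2) by (simp add: times_binomial_minus1_eq)
  ultimately have "p ^ i dvd j"
    by (simp add: coprime_dvd_mult_left_iff)
  then show False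
    using assms(2,3) by (simp add: nat_dvd_not_less)
qed

text \<open>The case of Lucas' theorem in which the lower entry is a power of \<open>p\<close>. Both sides vanish for
  \<open>n < p\<^sup>i\<close>, and both grow by \<open>1\<close> modulo \<open>p\<close> when \<open>n\<close> grows by \<open>p\<^sup>i\<close>: in Vandermonde's sum
  for \<open>p\<^sup>i + n choose p\<^sup>i\<close> only the two extreme terms survive modulo \<open>p\<close>.\<close>

lemma choose_prime_power_cong:
  fixes p :: nat
  assumes p: "prime p"
  shows "[n choose p ^ i = n div p ^ i] (mod p)"
proof -
  let ?s = "p ^ i"
  have s: "0 < ?s" using p by (simp add: prime_gt_0_nat)
  have step: "[(?s + n) choose ?s = (n choose ?s) + 1] (mod p)" for n
  proof -
    have "(?s + n) choose ?s = (\<Sum>k\<le>?s. (?s choose k) * (n choose (?s - k)))"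
      by (rule vandermonde[symmetric])
    also have "{..?s} = insert 0 (insert ?s {0<..<?s})" using s by auto
    also have "(\<Sum>k\<in>\<dots>. (?s choose k) * (n choose (?s - k)))
        = (n choose ?s) + 1 + (\<Sum>k\<in>{0<..<?s}. (?s choose k) * (n choose (?s - k)))"
      using s by simp
    finally have "(?s + n) choose ?s =
        (n choose ?s) + 1 + (\<Sum>k\<in>{0<..<?s}. (?s choose k) * (n choose (?s - k)))" .
    moreover have "p dvd (\<Sum>k\<in>{0<..<?s}. (?s choose k) * (n choose (?s - k)))"
      using p by (intro dvd_sum dvd_mult2 prime_dvd_choose_prime_power) auto
    ultimately show ?thesis by (auto simp: cong_def mod_add_right_eq elim!: dvdE)
  qed
  show ?thesis
  proof (induction n rule: less_induct)
    case (less n)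
    show ?case
    proof (cases "n < ?s")
      case False
      define k where "k = n - ?s"
      have n: "n = ?s + k" using False by (simp add: k_def)
      have "[k choose ?s = k div ?s] (mod p)" using less[of k] n s by simp
      then have "[(k choose ?s) + 1 = k div ?s + 1] (mod p)" by (intro cong_add) auto
      with step[of k] show ?thesis using s by (auto simp: n intro: cong_trans)
    qed (simp add: binomial_eq_0)
  qed
qed

section \<open>Integer functions generated by binomial coefficients\<close>

text \<open>The eigenvalues of the elements of \<open>C\<^sub>m\<close> on the monomials \<open>t\<^sup>a\<close>, lifted to the integers. Lifting
  makes the set independent of \<open>m\<close> and gives it pointwise arithmetic; in exchange, one operator
  comes from many of these functions.\<close>

inductive_set binomial_functions :: "nat \<Rightarrow> (nat \<Rightarrow> int) set" for p where
  const: "(\<lambda>a. c) \<in> binomial_functions p"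
| gen: "(\<lambda>a. - int ((a + p ^ i) choose p ^ i)) \<in> binomial_functions p"
| add: "\<phi> \<in> binomial_functions p \<Longrightarrow> \<psi> \<in> binomial_functions p \<Longrightarrow>
    (\<lambda>a. \<phi> a + \<psi> a) \<in> binomial_functions p"
| mult: "\<phi> \<in> binomial_functions p \<Longrightarrow> \<psi> \<in> binomial_functions p \<Longrightarrow>
    (\<lambda>a. \<phi> a * \<psi> a) \<in> binomial_functions p"

lemma binomial_functions_minus:
  "\<phi> \<in> binomial_functions p \<Longrightarrow> (\<lambda>a. - \<phi> a) \<in> binomial_functions p"
  using binomial_functions.mult[OF binomial_functions.const[of "-1"]] by simp

lemma binomial_functions_diff:
  "\<phi> \<in> binomial_functions p \<Longrightarrow> \<psi> \<in> binomial_functions p \<Longrightarrow>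
    (\<lambda>a. \<phi> a - \<psi> a) \<in> binomial_functions p"
  using binomial_functions.add[OF _ binomial_functions_minus] by simp

lemma binomial_functions_power:
  "\<phi> \<in> binomial_functions p \<Longrightarrow> (\<lambda>a. \<phi> a ^ n) \<in> binomial_functions p"
  by (induction n) (auto intro: binomial_functions.intros)

text \<open>Modulo \<open>p\<close> the generator with index \<open>i\<close> reads off the base \<open>p\<close> digit of \<open>a\<close> at \<open>p\<^sup>i\<close>, up to an
  affine change of variable. This is why polynomials in the generators see all digits of \<open>a\<close>,
  and each of them only finitely many.\<close>

lemma generator_cong:
  assumes "prime p"
  shows "[- int ((a + p ^ i) choose p ^ i) = - (int (a div p ^ i) + 1)] (mod int p)"
proof -
  have "[(a + p ^ i) choose p ^ i = (a + p ^ i) div p ^ i] (mod p)"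
    by (rule choose_prime_power_cong[OF assms])
  also have "(a + p ^ i) div p ^ i = a div p ^ i + 1"
    using assms by (simp add: prime_gt_0_nat)
  finally show ?thesis
    by (metis cong_int_iff cong_minus_minus_iff of_nat_1 of_nat_add)
qed

lemma mod_power_div_mod:
  fixes a p :: nat
  shows "a mod p ^ Suc i = a mod p ^ i + p ^ i * (a div p ^ i mod p)"
  by (metis add.commute mod_mult2_eq mult.commute power_Suc)

text \<open>A function on the natural numbers whose reduction modulo \<open>p\<close> has a power of \<open>p\<close> as a period extends,
  modulo \<open>p\<close>, to a locally constant function on the \<open>p\<close>-adic integers.\<close>

definition periodic_mod :: "nat \<Rightarrow> nat \<Rightarrow> (nat \<Rightarrow> int) \<Rightarrow> bool" where
  "periodic_mod p N \<phi> \<longleftrightarrow> (\<forall>a b. a mod p ^ N = b mod p ^ N \<longrightarrow> [\<phi> a = \<phi> b] (mod int p))"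

lemma periodic_mod_mono:
  assumes "periodic_mod p M \<phi>" "M \<le> N"
  shows "periodic_mod p N \<phi>"
proof -
  have "a mod p ^ M = b mod p ^ M" if "a mod p ^ N = b mod p ^ N" for a b
    using arg_cong[OF that, of "\<lambda>c. c mod p ^ M"]
    by (simp add: mod_mod_cancel[OF le_imp_power_dvd[OF assms(2)]])
  with assms(1) show ?thesis unfolding periodic_mod_def by blast
qed

text \<open>A common level makes periodicity stable under sums and products.\<close>

lemma periodic_mod_common:
  assumes "\<exists>N. periodic_mod p N \<phi>" "\<exists>N. periodic_mod p N \<psi>"
  obtains N where "periodic_mod p N \<phi>" "periodic_mod p N \<psi>"
  using assms by (metis periodic_mod_mono le_add1 le_add2)

lemma binomial_functions_periodic:
  assumes p: "prime p" and "\<phi> \<in> binomial_functions p"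
  shows "\<exists>N. periodic_mod p N \<phi>"
  using assms(2)
proof induction
  case (const c)
  then show ?case by (simp add: periodic_mod_def)
next
  case (gen i)
  have "[- int ((a + p ^ i) choose p ^ i) = - int ((b + p ^ i) choose p ^ i)] (mod int p)"
    if *: "a mod p ^ Suc i = b mod p ^ Suc i" for a b
  proof -
    have "a mod p ^ Suc i div p ^ i = a div p ^ i mod p" for a
      using p by (simp add: mod_power_div_mod prime_gt_0_nat del: power_Suc)
    then have "a div p ^ i mod p = b div p ^ i mod p" using * by metis
    then have "[int (a div p ^ i) = int (b div p ^ i)] (mod int p)"
      by (simp add: cong_def flip: of_nat_mod)
    then have "[- (int (a div p ^ i) + 1) = - (int (b div p ^ i) + 1)] (mod int p)"
      by (intro cong_add cong_minus_minus_iff[THEN iffD2]) auto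
    then show ?thesis
      using generator_cong[OF p] by (meson cong_sym cong_trans)
  qed
  then have "periodic_mod p (Suc i) (\<lambda>a. - int ((a + p ^ i) choose p ^ i))"
    unfolding periodic_mod_def by blast
  then show ?case by blast
next
  case (add \<phi> \<psi>)
  from add.IH obtain N where "periodic_mod p N \<phi>" "periodic_mod p N \<psi>"
    by (rule periodic_mod_common)
  then have "periodic_mod p N (\<lambda>a. \<phi> a + \<psi> a)"
    by (simp add: periodic_mod_def cong_add)
  then show ?case by blast
next
  case (mult \<phi> \<psi>)
  from mult.IH obtain N where "periodic_mod p N \<phi>" "periodic_mod p N \<psi>"
    by (rule periodic_mod_common)
  then have "periodic_mod p N (\<lambda>a. \<phi> a * \<psi> a)"
    by (simp add: periodic_mod_def cong_mult)
  then show ?case by blast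
qed

lemma fermat_int:
  assumes p: "prime p" and "\<not> int p dvd x"
  shows "[x ^ (p - 1) = 1] (mod int p)"
proof -
  define a where "a = nat (x mod int p)"
  have a: "int a = x mod int p" using p by (simp add: a_def prime_gt_0_nat)
  then have "\<not> p dvd a" using assms(2) by (metis dvd_mod_iff dvd_refl int_dvd_int_iff)
  then have "[a ^ (p - 1) = 1] (mod p)" by (rule fermat_theorem[OF p])
  then have "[int a ^ (p - 1) = 1] (mod int p)" by (metis cong_int_iff of_nat_1 of_nat_power)
  moreover have "[x ^ (p - 1) = int a ^ (p - 1)] (mod int p)"
    unfolding a by (intro cong_pow) (simp add: cong_def)
  ultimately show ?thesis by (metis cong_trans)
qed

text \<open>The digits of \<open>r\<close> are prescribed one at a time. The generator with index \<open>n\<close>, shifted by a constant,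
  is a function \<open>\<delta>\<close> that vanishes modulo \<open>p\<close> exactly where the digit at \<open>p\<^sup>n\<close> is that of \<open>r\<close>, and by
  Fermat's theorem \<open>1 - \<delta>\<^bsup>p - 1\<^esup>\<close> is the indicator of that condition modulo \<open>p\<close>.\<close>

lemma indicator_in_binomial_functions:
  assumes p: "prime p"
  shows "\<exists>\<psi>\<in>binomial_functions p.
    \<forall>a. [\<psi> a = (if a mod p ^ n = r mod p ^ n then 1 else 0)] (mod int p)"
proof (induction n)
  case 0
  show ?case by (rule bexI[OF _ binomial_functions.const[of 1]]) simp
next
  case (Suc n)
  then obtain \<psi> where \<psi>: "\<psi> \<in> binomial_functions p"
    "\<And>a. [\<psi> a = (if a mod p ^ n = r mod p ^ n then 1 else 0)] (mod int p)" by blast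
  let ?g = "\<lambda>a. - int ((a + p ^ n) choose p ^ n)"
  let ?\<delta> = "\<lambda>a. ?g a + (int (r div p ^ n) + 1)"
  let ?\<chi> = "\<lambda>a. \<psi> a * (1 - ?\<delta> a ^ (p - 1))"
  have \<delta>: "[?\<delta> a = int (r div p ^ n) - int (a div p ^ n)] (mod int p)" for a
    using cong_add[OF generator_cong[OF p, of a n] cong_refl[of "int (r div p ^ n) + 1"]] by simp
  have iff: "int p dvd ?\<delta> a \<longleftrightarrow> a div p ^ n mod p = r div p ^ n mod p" for a
  proof -
    have "int p dvd ?\<delta> a \<longleftrightarrow> int p dvd int (r div p ^ n) - int (a div p ^ n)"
      by (rule cong_dvd_iff[OF \<delta>])
    also have "\<dots> \<longleftrightarrow> [int (r div p ^ n) = int (a div p ^ n)] (mod int p)"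
      by (simp add: cong_iff_dvd_diff)
    finally have "int p dvd ?\<delta> a \<longleftrightarrow> [r div p ^ n = a div p ^ n] (mod p)"
      by (simp add: cong_int_iff)
    then show ?thesis by (auto simp: cong_def)
  qed
  have digits: "a mod p ^ Suc n = r mod p ^ Suc n \<longleftrightarrow>
      a mod p ^ n = r mod p ^ n \<and> a div p ^ n mod p = r div p ^ n mod p" for a
  proof
    assume *: "a mod p ^ Suc n = r mod p ^ Suc n"
    have "b mod p ^ n = b mod p ^ Suc n mod p ^ n" "b div p ^ n mod p = b mod p ^ Suc n div p ^ n" for b
      using p by (auto simp add: mod_power_div_mod prime_gt_0_nat mod_mod_cancel simp del: power_Suc)
    then show "a mod p ^ n = r mod p ^ n \<and> a div p ^ n mod p = r div p ^ n mod p"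
      using * by metis
  qed (simp add: mod_power_div_mod del: power_Suc)
  have "[?\<chi> a = (if a mod p ^ Suc n = r mod p ^ Suc n then 1 else 0)] (mod int p)" for a
  proof -
    have "[1 - ?\<delta> a ^ (p - 1) = (if a div p ^ n mod p = r div p ^ n mod p then 1 else 0)] (mod int p)"
    proof (cases "int p dvd ?\<delta> a")
      case True
      then have "int p dvd ?\<delta> a ^ (p - 1)"
        using prime_gt_1_nat[OF p] by (intro dvd_trans[OF _ dvd_power]) auto
      then have "[1 - ?\<delta> a ^ (p - 1) = 1 - 0] (mod int p)"
        by (intro cong_diff cong_refl) (simp add: cong_0_iff)
      then show ?thesis using iff[of a] True by simp
    next
      case False
      have "[1 - ?\<delta> a ^ (p - 1) = 1 - 1] (mod int p)"
        by (intro cong_diff cong_refl fermat_int[OF p False])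
      then show ?thesis using iff[of a] False by simp
    qed
    from cong_mult[OF \<psi>(2)[of a] this] show ?thesis
      unfolding digits by (auto split: if_splits)
  qed
  moreover have "?\<chi> \<in> binomial_functions p"
    by (intro binomial_functions.intros binomial_functions_diff binomial_functions_power \<psi>)
  ultimately show ?case by (intro bexI[of _ ?\<chi>] allI)
qed

section \<open>Diagonal operators on polynomials\<close>

definition diagonal_op :: "int \<Rightarrow> (nat \<Rightarrow> int) \<Rightarrow> (nat \<Rightarrow> int) \<Rightarrow> nat \<Rightarrow> int" where
  "diagonal_op q \<phi> = (\<lambda>f\<in>carrier (UP (residue_ring q)). \<lambda>a. (\<phi> a * f a) mod q)"

locale residue_polynomials =
  fixes q :: int
  assumes q_gt_1: "1 < q"
begin

abbreviation "A \<equiv> residue_ring q"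
abbreviation "E \<equiv> module_End A (UP A)"

lemma A_cring: "cring A"
  using residues.cring[of q] q_gt_1 by (simp add: residues_def)

sublocale poly: UP_cring A "UP A"
  by (simp add: UP_cring_def A_cring)

sublocale End: ring E
  by (rule poly.module_End_ring)

lemma A_simps:
  "carrier A = {0..<q}" "\<zero>\<^bsub>A\<^esub> = 0" "\<one>\<^bsub>A\<^esub> = 1"
  "x \<oplus>\<^bsub>A\<^esub> y = (x + y) mod q" "x \<otimes>\<^bsub>A\<^esub> y = (x * y) mod q"
  by (auto simp: residue_ring_def)

lemma A_nat_multiple: "x \<in> carrier A \<Longrightarrow> [k] \<cdot>\<^bsub>A\<^esub> x = (int k * x) mod q" for k :: nat
proof (induction k)
  case (Suc k)
  then show ?case by (simp add: A_simps mod_simps algebra_simps)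
qed (simp add: A_simps)

lemma coeff_apply: "f \<in> carrier (UP A) \<Longrightarrow> coeff (UP A) f a = f a"
  by (simp add: UP_def)

lemma coeff_range: "f \<in> carrier (UP A) \<Longrightarrow> 0 \<le> coeff (UP A) f a \<and> coeff (UP A) f a < q"
  using poly.coeff_closed[of f a] by (simp add: A_simps)

lemma diagonal_op_closed:
  assumes f: "f \<in> carrier (UP A)"
  shows "diagonal_op q \<phi> f \<in> carrier (UP A)"
proof -
  have "f \<in> up A" using f by (simp add: UP_def)
  then obtain n where "bound \<zero>\<^bsub>A\<^esub> n f" by (auto simp: up_def)
  then have "bound \<zero>\<^bsub>A\<^esub> n (\<lambda>a. (\<phi> a * f a) mod q)"
    by (auto simp: bound_def A_simps)
  then have "(\<lambda>a. (\<phi> a * f a) mod q) \<in> up A"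
    using q_gt_1 by (auto simp: up_def A_simps)
  then show ?thesis using f by (simp add: diagonal_op_def UP_def)
qed

lemma coeff_diagonal_op:
  assumes f: "f \<in> carrier (UP A)"
  shows "coeff (UP A) (diagonal_op q \<phi> f) a = (\<phi> a * coeff (UP A) f a) mod q"
  using f diagonal_op_closed[OF f, of \<phi>] by (simp add: coeff_apply) (simp add: diagonal_op_def)

lemma diagonal_op_extensional: "diagonal_op q \<phi> \<in> extensional (carrier (UP A))"
  by (simp add: diagonal_op_def)

lemma diagonal_op_in_End: "diagonal_op q \<phi> \<in> carrier E"
proof -
  have "diagonal_op q \<phi> (f \<oplus>\<^bsub>UP A\<^esub> g) = diagonal_op q \<phi> f \<oplus>\<^bsub>UP A\<^esub> diagonal_op q \<phi> g"
    if "f \<in> carrier (UP A)" "g \<in> carrier (UP A)" for f g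
    using that by (intro poly.up_eqI)
      (simp_all add: coeff_diagonal_op diagonal_op_closed A_simps mod_simps algebra_simps)
  moreover have "diagonal_op q \<phi> (c \<odot>\<^bsub>UP A\<^esub> f) = c \<odot>\<^bsub>UP A\<^esub> diagonal_op q \<phi> f"
    if "c \<in> carrier A" "f \<in> carrier (UP A)" for c f
    using that by (intro poly.up_eqI)
      (simp_all add: coeff_diagonal_op diagonal_op_closed A_simps(5) mod_simps algebra_simps)
  ultimately show ?thesis
    by (auto simp: module_End_def PiE_def diagonal_op_closed diagonal_op_extensional)
qed

text \<open>Coefficients determine an extensional endomorphism, so identities between operators reduce to
  identities between eigenvalues.\<close>

lemma End_eq_diagonal_opI:
  assumes "g \<in> carrier E"
    and "\<And>f a. f \<in> carrier (UP A) \<Longrightarrow> coeff (UP A) (g f) a = (\<phi> a * coeff (UP A) f a) mod q"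
  shows "g = diagonal_op q \<phi>"
proof (rule extensionalityI[of _ "carrier (UP A)"])
  show "g \<in> extensional (carrier (UP A))"
    using assms(1) by (auto simp: module_End_def PiE_def)
  show "g f = diagonal_op q \<phi> f" if f: "f \<in> carrier (UP A)" for f
    using assms f by (intro poly.up_eqI)
      (auto simp: coeff_diagonal_op diagonal_op_closed module_End_def)
qed (rule diagonal_op_extensional)

lemma End_apply:
  assumes "f \<in> carrier (UP A)"
  shows "(g \<otimes>\<^bsub>E\<^esub> h) f = g (h f)" "(g \<oplus>\<^bsub>E\<^esub> h) f = g f \<oplus>\<^bsub>UP A\<^esub> h f"
    "\<one>\<^bsub>E\<^esub> f = f" "\<zero>\<^bsub>E\<^esub> f = \<zero>\<^bsub>UP A\<^esub>" "(c \<odot>\<^bsub>E\<^esub> g) f = c \<odot>\<^bsub>UP A\<^esub> g f"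
  using assms by (simp_all add: module_End_def compose_def)

lemma diagonal_op_mult:
  "diagonal_op q \<phi> \<otimes>\<^bsub>E\<^esub> diagonal_op q \<psi> = diagonal_op q (\<lambda>a. \<phi> a * \<psi> a)"
  by (rule End_eq_diagonal_opI)
    (simp_all add: diagonal_op_in_End End_apply diagonal_op_closed coeff_diagonal_op mod_simps mult.assoc)

lemma diagonal_op_add:
  "diagonal_op q \<phi> \<oplus>\<^bsub>E\<^esub> diagonal_op q \<psi> = diagonal_op q (\<lambda>a. \<phi> a + \<psi> a)"
  by (rule End_eq_diagonal_opI)
    (simp_all add: diagonal_op_in_End End_apply diagonal_op_closed coeff_diagonal_op A_simps mod_simps algebra_simps)

lemma diagonal_op_one: "\<one>\<^bsub>E\<^esub> = diagonal_op q (\<lambda>a. 1)"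
  using coeff_range by (intro End_eq_diagonal_opI) (simp_all add: End_apply)

lemma diagonal_op_zero: "\<zero>\<^bsub>E\<^esub> = diagonal_op q (\<lambda>a. 0)"
  by (rule End_eq_diagonal_opI) (simp_all add: End_apply A_simps)

lemma diagonal_op_minus: "\<ominus>\<^bsub>E\<^esub> diagonal_op q \<phi> = diagonal_op q (\<lambda>a. - \<phi> a)"
  by (rule End.minus_equality) (simp_all add: diagonal_op_in_End diagonal_op_add diagonal_op_zero)

lemma diagonal_op_smult:
  assumes "c \<in> carrier A"
  shows "c \<odot>\<^bsub>E\<^esub> diagonal_op q \<phi> = diagonal_op q (\<lambda>a. c * \<phi> a)"
proof -
  have "c \<odot>\<^bsub>E\<^esub> diagonal_op q \<phi> = diagonal_op q (\<lambda>a. c) \<otimes>\<^bsub>E\<^esub> diagonal_op q \<phi>"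
  proof (rule extensionalityI[of _ "carrier (UP A)"])
    show "(c \<odot>\<^bsub>E\<^esub> diagonal_op q \<phi>) f = (diagonal_op q (\<lambda>a. c) \<otimes>\<^bsub>E\<^esub> diagonal_op q \<phi>) f"
      if f: "f \<in> carrier (UP A)" for f
      using f assms by (intro poly.up_eqI)
        (simp_all add: End_apply diagonal_op_closed coeff_diagonal_op A_simps(5))
  qed (simp_all add: module_End_def)
  then show ?thesis by (simp add: diagonal_op_mult)
qed

lemma diagonal_op_eq_iff:
  "diagonal_op q \<phi> = diagonal_op q \<psi> \<longleftrightarrow> (\<forall>a. [\<phi> a = \<psi> a] (mod q))"
proof
  assume eq: "diagonal_op q \<phi> = diagonal_op q \<psi>"
  have "\<phi> a mod q = \<psi> a mod q" for a
  proof -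
    have "coeff (UP A) (diagonal_op q \<chi> (monom (UP A) \<one>\<^bsub>A\<^esub> a)) a = \<chi> a mod q" for \<chi>
      by (simp add: coeff_diagonal_op) (simp add: A_simps)
    then show ?thesis using eq by metis
  qed
  then show "\<forall>a. [\<phi> a = \<psi> a] (mod q)" by (simp add: cong_def)
next
  assume *: "\<forall>a. [\<phi> a = \<psi> a] (mod q)"
  show "diagonal_op q \<phi> = diagonal_op q \<psi>"
    unfolding diagonal_op_def using * by (intro restrict_ext ext) (metis cong_def cong_scalar_right)
qed

text \<open>Multiplying by \<open>t\<^sup>k\<close> moves the coefficient at \<open>a\<close> to \<open>a + k\<close>, and the divided derivative moves it back
  with the factor \<open>a + k choose k\<close>. So the generators of \<open>C\<^sub>m\<close> are diagonal.\<close>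

lemma hasse_mult_monom_eq_diagonal_op:
  "hasse_deriv A k \<otimes>\<^bsub>E\<^esub> mult_by_monom A k = diagonal_op q (\<lambda>a. int ((a + k) choose k))"
proof (rule End_eq_diagonal_opI)
  show "hasse_deriv A k \<otimes>\<^bsub>E\<^esub> mult_by_monom A k \<in> carrier E"
    by (intro End.m_closed poly.hasse_deriv_in_End poly.mult_by_monom_in_End)
next
  fix f a assume f: "f \<in> carrier (UP A)"
  have "coeff (UP A) (monom (UP A) \<one>\<^bsub>A\<^esub> k \<otimes>\<^bsub>UP A\<^esub> f) (a + k)
      = (\<Oplus>\<^bsub>A\<^esub>i\<in>{..a + k}. if k = i then coeff (UP A) f a else \<zero>\<^bsub>A\<^esub>)"
    using f by (simp add: poly.coeff_mult) (intro poly.R.finsum_cong', auto)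
  also have "\<dots> = coeff (UP A) f a"
    using f poly.R.finsum_singleton[of k "{..a + k}" "\<lambda>_. coeff (UP A) f a"] by simp
  finally have "coeff (UP A) (mult_by_monom A k f) (a + k) = coeff (UP A) f a"
    using f by (simp add: mult_by_monom_def)
  moreover have "mult_by_monom A k f \<in> carrier (UP A)"
    using f poly.mult_by_monom_in_End[of k] by (auto simp: module_End_def)
  ultimately show "coeff (UP A) ((hasse_deriv A k \<otimes>\<^bsub>E\<^esub> mult_by_monom A k) f) a
      = (int ((a + k) choose k) * coeff (UP A) f a) mod q"
    using f by (simp add: End_apply poly.coeff_hasse_deriv A_nat_multiple)
qed

end

section \<open>The algebra as a ring of diagonal operators\<close>

locale prime_power_algebra =
  fixes p m :: nat
  assumes prime_p: "prime p"
begin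

text \<open>A constant instead of a plain abbreviation, so that simplification cannot rewrite the power inside
  the terms \<open>diagonal_op modulus \<phi>\<close>.\<close>

definition modulus :: int where "modulus = int (p ^ (m + 1))"
abbreviation "C \<equiv> C_alg p m"
abbreviation "F \<equiv> binomial_functions p"
abbreviation "diag \<equiv> diagonal_op modulus"

lemma p_pos: "0 < p" and p_gt_1: "1 < p"
  using prime_gt_0_nat[OF prime_p] prime_gt_1_nat[OF prime_p] .

sublocale residue_polynomials modulus
  unfolding modulus_def using p_gt_1 by unfold_locales (metis of_nat_1 of_nat_less_iff one_less_power zero_less_Suc Suc_eq_plus1)

lemma generator_eq:
  "\<ominus>\<^bsub>E\<^esub> (hasse_deriv A (p ^ i) \<otimes>\<^bsub>E\<^esub> mult_by_monom A (p ^ i)) = diag (\<lambda>a. - int ((a + p ^ i) choose p ^ i))"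
  by (simp only: hasse_mult_monom_eq_diagonal_op diagonal_op_minus)

lemma subring_diagonal: "subring (diag ` F) E"
proof (rule End.subringI)
  show "\<one>\<^bsub>E\<^esub> \<in> diag ` F"
    unfolding diagonal_op_one by (intro imageI binomial_functions.const)
qed (auto simp: diagonal_op_in_End diagonal_op_minus diagonal_op_mult diagonal_op_add
      intro!: imageI binomial_functions.intros binomial_functions_minus)

text \<open>The diagonal operators with eigenvalues in \<^term>\<open>F\<close> form a subalgebra that contains the generators.
  Conversely a subalgebra contains the scalar multiples of the identity, which account for the
  constants in \<^term>\<open>F\<close>.\<close>

lemma carrier_C: "carrier C = diag ` F"
proof -
  let ?G = "range (\<lambda>i. \<ominus>\<^bsub>E\<^esub> (hasse_deriv A (p ^ i) \<otimes>\<^bsub>E\<^esub> mult_by_monom A (p ^ i)))"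
  have "carrier C = subalgebra_generated A E ?G"
    by (simp add: C_alg_def Let_def modulus_def)
  also have "\<dots> = diag ` F"
  proof
    have "\<forall>a\<in>carrier A. \<forall>x\<in>diag ` F. a \<odot>\<^bsub>E\<^esub> x \<in> diag ` F"
      by (auto simp: diagonal_op_smult intro!: imageI binomial_functions.intros)
    moreover have "?G \<subseteq> diag ` F"
      unfolding generator_eq by (auto intro!: imageI binomial_functions.gen)
    ultimately show "subalgebra_generated A E ?G \<subseteq> diag ` F"
      unfolding subalgebra_generated_def using subring_diagonal by blast
  next
    have "diag \<phi> \<in> B"
      if B: "subring B E" "\<forall>a\<in>carrier A. \<forall>x\<in>B. a \<odot>\<^bsub>E\<^esub> x \<in> B" "?G \<subseteq> B" and "\<phi> \<in> F" for B \<phi>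
      using \<open>\<phi> \<in> F\<close>
    proof induction
      case (const c)
      have c: "c mod modulus \<in> carrier A" using q_gt_1 by (simp add: A_simps)
      then have "(c mod modulus) \<odot>\<^bsub>E\<^esub> \<one>\<^bsub>E\<^esub> \<in> B" using B(2) subringE(3)[OF B(1)] by blast
      also have "(c mod modulus) \<odot>\<^bsub>E\<^esub> \<one>\<^bsub>E\<^esub> = diag (\<lambda>a. c)"
        by (simp only: diagonal_op_one diagonal_op_smult[OF c] diagonal_op_eq_iff) (simp add: cong_def)
      finally show ?case .
    next
      case (gen i)
      then show ?case using B(3) unfolding generator_eq by blast
    qed (simp_all add: subringE[OF B(1)] flip: diagonal_op_add diagonal_op_mult)
    then show "diag ` F \<subseteq> subalgebra_generated A E ?G"
      unfolding subalgebra_generated_def by blast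
  qed
  finally show ?thesis .
qed

lemma C_eq: "C = E\<lparr>carrier := diag ` F\<rparr>"
  using carrier_C by (simp add: C_alg_def Let_def modulus_def)

lemma cring_C: "cring C"
  unfolding C_eq
  by (rule End.subcring_iff[THEN iffD1, OF _ End.subcringI[OF subring_diagonal]])
    (auto simp: diagonal_op_in_End diagonal_op_mult mult.commute)

sublocale C: cring C
  by (rule cring_C)

lemma C_ops:
  "diag \<phi> \<otimes>\<^bsub>C\<^esub> diag \<psi> = diag (\<lambda>a. \<phi> a * \<psi> a)"
  "diag \<phi> \<oplus>\<^bsub>C\<^esub> diag \<psi> = diag (\<lambda>a. \<phi> a + \<psi> a)"
  "\<one>\<^bsub>C\<^esub> = diag (\<lambda>a. 1)" "\<zero>\<^bsub>C\<^esub> = diag (\<lambda>a. 0)"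
  using diagonal_op_mult diagonal_op_add diagonal_op_one diagonal_op_zero
  by (simp_all add: C_eq)

lemma diag_in_C: "\<phi> \<in> F \<Longrightarrow> diag \<phi> \<in> carrier C"
  by (simp add: carrier_C)

lemma C_minus: "\<phi> \<in> F \<Longrightarrow> \<ominus>\<^bsub>C\<^esub> diag \<phi> = diag (\<lambda>a. - \<phi> a)"
  by (rule C.minus_equality) (simp_all add: C_ops diag_in_C binomial_functions_minus)

section \<open>Prime ideals\<close>

lemma ideal_add:
  assumes "ideal J C" "diag \<phi> \<in> J" "diag \<psi> \<in> J"
  shows "diag (\<lambda>a. \<phi> a + \<psi> a) \<in> J"
proof -
  interpret ideal J C by fact
  show ?thesis using a_closed[OF assms(2,3)] by (simp add: C_ops)
qed

lemma ideal_mult: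
  assumes "ideal J C" "diag \<phi> \<in> J" "\<psi> \<in> F"
  shows "diag (\<lambda>a. \<psi> a * \<phi> a) \<in> J"
proof -
  interpret ideal J C by fact
  show ?thesis using I_l_closed[OF assms(2) diag_in_C[OF assms(3)]] by (simp add: C_ops)
qed

lemma ideal_one:
  assumes "ideal J C" "diag (\<lambda>a. 1) \<in> J"
  shows "J = carrier C"
  using ideal.one_imp_carrier[OF assms(1)] assms(2) by (simp add: C_ops)

lemma prime_ideal: "primeideal P C \<Longrightarrow> ideal P C"
  by (simp add: primeideal_def)

lemma prime_mult:
  assumes "primeideal P C" "\<phi> \<in> F" "\<psi> \<in> F" "diag (\<lambda>a. \<phi> a * \<psi> a) \<in> P"
  shows "diag \<phi> \<in> P \<or> diag \<psi> \<in> P"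
  using primeideal.I_prime[OF assms(1) diag_in_C[OF assms(2)] diag_in_C[OF assms(3)]] assms(4)
  by (simp add: C_ops)

lemma prime_one: "primeideal P C \<Longrightarrow> diag (\<lambda>a. 1) \<notin> P"
  using ideal_one prime_ideal primeideal.I_notcarr by metis

lemma prime_prod:
  assumes P: "primeideal P C" and "finite S" "\<And>s. s \<in> S \<Longrightarrow> \<phi> s \<in> F"
    "diag (\<lambda>a. \<Prod>s\<in>S. \<phi> s a) \<in> P"
  shows "\<exists>s\<in>S. diag (\<phi> s) \<in> P"
proof -
  have "(\<lambda>a. \<Prod>s\<in>S. \<phi> s a) \<in> F \<and> (diag (\<lambda>a. \<Prod>s\<in>S. \<phi> s a) \<in> P \<longrightarrow> (\<exists>s\<in>S. diag (\<phi> s) \<in> P))"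
    using assms(2,3)
  proof (induction S rule: finite_induct)
    case empty
    then show ?case using prime_one[OF P] by (simp add: binomial_functions.const)
  next
    case (insert s S)
    then show ?case using prime_mult[OF P, of "\<phi> s" "\<lambda>a. \<Prod>s\<in>S. \<phi> s a"]
      by (auto intro: binomial_functions.mult)
  qed
  then show ?thesis using assms(4) by blast
qed

text \<open>The power with exponent \<open>m + 1\<close> of a function that is divisible by \<open>p\<close> vanishes modulo \<open>p\<^bsup>m + 1\<^esup>\<close>,
  so such a function gives a nilpotent operator. Hence prime ideals only see functions modulo \<open>p\<close>.\<close>

lemma prime_contains_p_multiples:
  assumes P: "primeideal P C" and \<phi>: "\<phi> \<in> F" "\<And>a. int p dvd \<phi> a"
  shows "diag \<phi> \<in> P"
proof -
  interpret primeideal P C by fact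
  \<comment> \<open>Written as a product of equal factors so that primality applies to it.\<close>
  have "modulus dvd (\<Prod>s\<in>{..m}. \<phi> a)" for a
    using dvd_power_same[OF \<phi>(2), of "m + 1" a] by (simp add: modulus_def)
  then have "diag (\<lambda>a. \<Prod>s\<in>{..m}. \<phi> a) = diag (\<lambda>a. 0)"
    unfolding diagonal_op_eq_iff cong_0_iff by blast
  also have "\<dots> \<in> P" using additive_subgroup.zero_closed[OF is_additive_subgroup] by (simp add: C_ops)
  finally show ?thesis using prime_prod[OF P, of "{..m}" "\<lambda>s. \<phi>"] \<phi>(1) by auto
qed

lemma prime_cong:
  assumes P: "primeideal P C" and "\<phi> \<in> F" "\<psi> \<in> F" "\<And>a. [\<phi> a = \<psi> a] (mod int p)" "diag \<phi> \<in> P"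
  shows "diag \<psi> \<in> P"
proof -
  have "diag (\<lambda>a. \<psi> a - \<phi> a) \<in> P"
    using assms by (intro prime_contains_p_multiples binomial_functions_diff)
      (auto simp: cong_iff_dvd_diff dvd_diff_commute)
  from ideal_add[OF prime_ideal[OF P] this assms(5)] show ?thesis by simp
qed

text \<open>Modulo \<open>p\<close> every \<open>\<phi>\<close> satisfies \<open>\<phi> \<cdot> (1 - \<phi>\<^bsup>p - 1\<^esup>) = 0\<close>. So \<open>\<phi>\<close> is invertible modulo a prime ideal
  that does not contain it, with inverse \<open>\<phi>\<^bsup>p - 2\<^esup>\<close>.\<close>

lemma prime_imp_maximal:
  assumes P: "primeideal P C"
  shows "maximalideal P C"
proof (rule maximalidealI)
  show "ideal P C" using P by (rule prime_ideal)
  show "carrier C \<noteq> P" using P by (rule primeideal.I_notcarr)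
  fix J assume J: "ideal J C" "P \<subseteq> J" "J \<subseteq> carrier C"
  show "J = P \<or> J = carrier C"
  proof (cases "J \<subseteq> P")
    case False
    then obtain \<phi> where \<phi>: "\<phi> \<in> F" "diag \<phi> \<in> J" "diag \<phi> \<notin> P"
      using J(3) unfolding carrier_C by blast
    have F: "(\<lambda>a. 1 - \<phi> a ^ (p - 1)) \<in> F"
      by (intro binomial_functions_diff binomial_functions.const binomial_functions_power \<phi>)
    have "int p dvd \<phi> a * (1 - \<phi> a ^ (p - 1))" for a
      using fermat_int[OF prime_p, of "\<phi> a"]
      by (cases "int p dvd \<phi> a") (auto simp: cong_iff_dvd_diff dvd_diff_commute)
    then have "diag (\<lambda>a. \<phi> a * (1 - \<phi> a ^ (p - 1))) \<in> P"
      by (intro prime_contains_p_multiples[OF P] binomial_functions.mult \<phi> F)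
    then have "diag (\<lambda>a. 1 - \<phi> a ^ (p - 1)) \<in> J"
      using prime_mult[OF P \<phi>(1) F] \<phi>(3) J(2) by blast
    moreover have "diag (\<lambda>a. \<phi> a ^ (p - 2) * \<phi> a) \<in> J"
      by (intro ideal_mult J \<phi> binomial_functions_power)
    \<comment> \<open>So \<open>\<phi>\<^bsup>p - 1\<^esup>\<close> is the multiple of \<open>\<phi>\<close> just found, and adding it to \<open>1 - \<phi>\<^bsup>p - 1\<^esup>\<close> gives \<open>1\<close>.\<close>
    moreover have "p - 1 = Suc (p - 2)" using p_gt_1 by simp
    ultimately have "diag (\<lambda>a. 1) \<in> J"
      using ideal_add[OF J(1)] by fastforce
    then show ?thesis using ideal_one[OF J(1)] by blast
  qed (use J in blast)
qed

text \<open>A chosen integral lift, within \<^term>\<open>F\<close>, of the indicator modulo \<open>p\<close> of a residue class modulo \<open>p\<^sup>n\<close>.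
  In the quotient of \<^term>\<open>C\<close> by its nilradical these are the idempotents of the cosets of
  \<open>p\<^sup>n \<int>\<^sub>p\<close>.\<close>

definition indicator_fun :: "nat \<Rightarrow> nat \<Rightarrow> nat \<Rightarrow> int" where
  "indicator_fun n r = (SOME \<psi>. \<psi> \<in> F \<and>
     (\<forall>a. [\<psi> a = (if a mod p ^ n = r mod p ^ n then 1 else 0)] (mod int p)))"

lemma indicator_fun:
  "indicator_fun n r \<in> F"
  "[indicator_fun n r a = (if a mod p ^ n = r mod p ^ n then 1 else 0)] (mod int p)"
proof -
  have "\<exists>\<psi>. \<psi> \<in> F \<and> (\<forall>a. [\<psi> a = (if a mod p ^ n = r mod p ^ n then 1 else 0)] (mod int p))"
    using indicator_in_binomial_functions[OF prime_p] by blast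
  from someI_ex[OF this] show "indicator_fun n r \<in> F"
    "[indicator_fun n r a = (if a mod p ^ n = r mod p ^ n then 1 else 0)] (mod int p)"
    unfolding indicator_fun_def by blast+
qed

lemma p_dvd_indicator_fun: "int p dvd indicator_fun n r a \<longleftrightarrow> a mod p ^ n \<noteq> r mod p ^ n"
  using cong_dvd_iff[OF indicator_fun(2)[of n r a]] p_gt_1 by (simp split: if_splits)

text \<open>Every \<open>a\<close> lies in one of the \<open>p\<^sup>n\<close> residue classes, so the product of the complementary indicators
  vanishes modulo \<open>p\<close>. A prime ideal contains one of the factors, and then not the corresponding indicator.\<close>

lemma prime_selects_residue:
  assumes P: "primeideal P C"
  shows "\<exists>r<p ^ n. diag (indicator_fun n r) \<notin> P"
proof -
  let ?c = "\<lambda>r a. 1 - indicator_fun n r a"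
  have F: "?c r \<in> F" for r
    by (intro binomial_functions_diff binomial_functions.const indicator_fun)
  have prod_F: "(\<lambda>a. \<Prod>r\<in>S. ?c r a) \<in> F" if "finite S" for S
    using that by (induction S rule: finite_induct) (auto intro: binomial_functions.const binomial_functions.mult F)
  have "int p dvd (\<Prod>r<p ^ n. ?c r a)" for a
  proof -
    have "int p dvd ?c (a mod p ^ n) a"
      using indicator_fun(2)[of n "a mod p ^ n" a] by (simp add: cong_iff_dvd_diff dvd_diff_commute)
    then show ?thesis
      using p_pos by (intro dvd_trans[OF _ dvd_prodI[of _ "a mod p ^ n"]]) auto
  qed
  then have "diag (\<lambda>a. \<Prod>r<p ^ n. ?c r a) \<in> P"
    by (intro prime_contains_p_multiples[OF P] prod_F) auto
  then obtain r where r: "r < p ^ n" "diag (?c r) \<in> P"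
    using prime_prod[OF P, of "{..<p ^ n}" ?c] F by auto
  have "diag (indicator_fun n r) \<notin> P"
    using ideal_add[OF prime_ideal[OF P] r(2), of "indicator_fun n r"] prime_one[OF P] by auto
  with r(1) show ?thesis by blast
qed

text \<open>Indicators of disjoint classes have product \<open>0\<close> modulo \<open>p\<close>, so the ideal must contain one of them.
  The residues that a prime ideal selects at all levels thus form one \<open>p\<close>-adic integer.\<close>

lemma prime_selects_compatible_residues:
  assumes P: "primeideal P C"
    and "diag (indicator_fun n r) \<notin> P" "diag (indicator_fun k s) \<notin> P" "k \<le> n"
  shows "r mod p ^ k = s mod p ^ k"
proof (rule ccontr)
  assume ne: "r mod p ^ k \<noteq> s mod p ^ k"
  have "int p dvd indicator_fun n r a * indicator_fun k s a" for a
  proof -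
    have "a mod p ^ n \<noteq> r mod p ^ n \<or> a mod p ^ k \<noteq> s mod p ^ k"
      using ne assms(4) by (metis le_imp_power_dvd mod_mod_cancel)
    then show ?thesis by (auto simp flip: p_dvd_indicator_fun)
  qed
  then have "diag (\<lambda>a. indicator_fun n r a * indicator_fun k s a) \<in> P"
    by (intro prime_contains_p_multiples[OF P] binomial_functions.mult indicator_fun)
  then show False using prime_mult[OF P] indicator_fun(1) assms(2,3) by blast
qed

lemma prime_contains_constant_iff:
  assumes P: "primeideal P C"
  shows "diag (\<lambda>a. c) \<in> P \<longleftrightarrow> int p dvd c"
proof
  assume c: "diag (\<lambda>a. c) \<in> P"
  show "int p dvd c"
  proof (rule ccontr)
    assume "\<not> int p dvd c"
    then have *: "[c ^ (p - 2) * c = 1] (mod int p)"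
      using fermat_int[OF prime_p, of c] p_gt_1 by (simp flip: power_Suc2 add: Suc_diff_Suc numeral_2_eq_2)
    have "diag (\<lambda>a. c ^ (p - 2) * c) \<in> P"
      by (rule ideal_mult[OF prime_ideal[OF P] c binomial_functions.const])
    from prime_cong[OF P binomial_functions.const binomial_functions.const * this] show False
      using prime_one[OF P] by simp
  qed
qed (simp add: prime_contains_p_multiples[OF P] binomial_functions.const)

text \<open>If \<open>\<phi>\<close> depends modulo \<open>p\<close> only on \<open>a mod p\<^sup>N\<close>, then \<open>\<phi> - \<phi>(r)\<close> is killed modulo \<open>p\<close> by the indicator of
  \<open>r\<close>. When the prime ideal does not contain this indicator, it identifies \<open>\<phi>\<close> with the
  constant \<open>\<phi>(r)\<close>; so the selected residues determine the ideal.\<close>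

lemma prime_contains_iff:
  assumes P: "primeideal P C" and \<phi>: "\<phi> \<in> F"
    and N: "periodic_mod p N \<phi>"
    and r: "diag (indicator_fun N r) \<notin> P"
  shows "diag \<phi> \<in> P \<longleftrightarrow> int p dvd \<phi> r"
proof -
  have F: "(\<lambda>a. \<phi> a - \<phi> r) \<in> F"
    by (intro binomial_functions_diff binomial_functions.const \<phi>)
  have "int p dvd (\<phi> a - \<phi> r) * indicator_fun N r a" for a
    using N p_dvd_indicator_fun[of N r a]
    by (cases "a mod p ^ N = r mod p ^ N") (auto simp: periodic_mod_def cong_iff_dvd_diff)
  then have "diag (\<lambda>a. (\<phi> a - \<phi> r) * indicator_fun N r a) \<in> P"
    by (intro prime_contains_p_multiples[OF P] binomial_functions.mult F indicator_fun)
  then have *: "diag (\<lambda>a. \<phi> a - \<phi> r) \<in> P"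
    using prime_mult[OF P F indicator_fun(1)] r by blast
  have "diag \<phi> \<in> P \<longleftrightarrow> diag (\<lambda>a. \<phi> r) \<in> P"
  proof
    assume "diag \<phi> \<in> P"
    then have "diag (\<lambda>a. -1 * (\<phi> a - \<phi> r) + \<phi> a) \<in> P"
      by (intro ideal_add ideal_mult prime_ideal[OF P] * binomial_functions.const)
    then show "diag (\<lambda>a. \<phi> r) \<in> P" by simp
  next
    assume "diag (\<lambda>a. \<phi> r) \<in> P"
    from ideal_add[OF prime_ideal[OF P] * this] show "diag \<phi> \<in> P" by simp
  qed
  then show ?thesis by (simp add: prime_contains_constant_iff[OF P])
qed

section \<open>Points of the spectrum as p-adic integers\<close>

abbreviation "Z \<equiv> padic_ints p"

lemma padic_nat:
  assumes "x \<in> carrier Z"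
  shows "int (nat (x n)) = x n" "nat (x n) < p ^ n"
  using assms by (auto simp: padic_ints_def nat_less_iff)

lemma padic_mod:
  assumes x: "x \<in> carrier Z" and "k \<le> n"
  shows "nat (x n) mod p ^ k = nat (x k)"
proof -
  have "x n mod int p ^ k = x k" using assms(2)
  proof (induction n rule: dec_induct)
    case base
    then show ?case using x by (simp add: padic_ints_def)
  next
    case (step n)
    have "x (Suc n) mod int p ^ k = x (Suc n) mod int p ^ n mod int p ^ k"
      using step by (simp add: mod_mod_cancel le_imp_power_dvd)
    also have "\<dots> = x k" using x step by (simp add: padic_ints_def)
    finally show ?case .
  qed
  then have "int (nat (x n) mod p ^ k) = int (nat (x k))"
    using padic_nat(1)[OF x] by (simp only: of_nat_mod of_nat_power)
  then show ?thesis by (simp only: of_nat_eq_iff)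
qed

text \<open>The kernel of evaluation at \<open>x\<close>, as a map to the field with \<open>p\<close> elements. The value of \<open>\<phi>\<close> at a
  \<open>p\<close>-adic integer is the eventual value of \<open>\<phi>\<close> modulo \<open>p\<close> along the approximations \<open>x n\<close>.\<close>

definition point_ideal :: "(nat \<Rightarrow> int) \<Rightarrow> ((nat \<Rightarrow> int) \<Rightarrow> nat \<Rightarrow> int) set" where
  "point_ideal x = diag ` {\<phi> \<in> F. \<forall>\<^sub>F n in sequentially. int p dvd \<phi> (nat (x n))}"

text \<open>Membership is decided by one approximation of \<open>x\<close>. This includes that it does not depend on the choice of
  the lift \<open>\<phi>\<close>, as two lifts of one operator agree modulo \<open>p\<close>.\<close>

lemma diag_in_point_ideal_iff:
  assumes x: "x \<in> carrier Z" and \<phi>: "\<phi> \<in> F"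
    and N: "periodic_mod p N \<phi>"
  shows "diag \<phi> \<in> point_ideal x \<longleftrightarrow> int p dvd \<phi> (nat (x N))"
proof -
  have dvd: "int p dvd \<phi> (nat (x n)) \<longleftrightarrow> int p dvd \<phi> (nat (x N))" if "N \<le> n" for n
  proof (rule cong_dvd_iff)
    have "nat (x n) mod p ^ N = nat (x N) mod p ^ N"
      using padic_mod[OF x, of N] that by simp
    then show "[\<phi> (nat (x n)) = \<phi> (nat (x N))] (mod int p)"
      using N by (simp add: periodic_mod_def)
  qed
  show ?thesis
  proof
    assume "diag \<phi> \<in> point_ideal x"
    then obtain \<psi> where \<psi>: "\<psi> \<in> F" "diag \<phi> = diag \<psi>" "\<forall>\<^sub>F n in sequentially. int p dvd \<psi> (nat (x n))"
      by (auto simp: point_ideal_def)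
    have "int p dvd modulus" by (simp add: modulus_def)
    then have "int p dvd \<psi> a \<longleftrightarrow> int p dvd \<phi> a" for a
      using \<psi>(2) unfolding diagonal_op_eq_iff by (metis cong_dvd_iff cong_dvd_modulus)
    with \<psi>(3) have "\<forall>\<^sub>F n in sequentially. int p dvd \<phi> (nat (x n))" by simp
    then obtain M where "\<And>n. n \<ge> M \<Longrightarrow> int p dvd \<phi> (nat (x n))"
      by (auto simp: eventually_sequentially)
    from this[of "max M N"] show "int p dvd \<phi> (nat (x N))" using dvd[of "max M N"] by simp
  next
    assume "int p dvd \<phi> (nat (x N))"
    then have "\<forall>\<^sub>F n in sequentially. int p dvd \<phi> (nat (x n))"
      unfolding eventually_sequentially using dvd by blast
    with \<phi> show "diag \<phi> \<in> point_ideal x" by (auto simp: point_ideal_def)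
  qed
qed

lemma indicator_in_point_ideal_iff:
  assumes x: "x \<in> carrier Z"
  shows "diag (indicator_fun n r) \<in> point_ideal x \<longleftrightarrow> nat (x n) \<noteq> r mod p ^ n"
proof -
  have "periodic_mod p n (indicator_fun n r)"
    unfolding periodic_mod_def
    using indicator_fun(2)[of n r] by (metis cong_sym cong_trans)
  then have "diag (indicator_fun n r) \<in> point_ideal x \<longleftrightarrow> int p dvd indicator_fun n r (nat (x n))"
    by (intro diag_in_point_ideal_iff[OF x indicator_fun(1)])
  then show ?thesis
    using padic_nat(2)[OF x, of n] by (simp add: p_dvd_indicator_fun)
qed

text \<open>The values of the two factors are taken at one approximation of \<open>x\<close> that is good enough for both; there
  primality of the ideal becomes primality of \<open>p\<close>.\<close>

lemma primeideal_point_ideal: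
  assumes x: "x \<in> carrier Z"
  shows "primeideal (point_ideal x) C"
proof (rule primeidealI2)
  show "additive_subgroup (point_ideal x) C"
  proof (rule additive_subgroup.intro, rule C.add.subgroupI)
    show "point_ideal x \<subseteq> carrier C" by (auto simp: point_ideal_def carrier_C)
    have "diag (\<lambda>a. 0) \<in> point_ideal x"
      unfolding point_ideal_def by (intro imageI) (simp add: binomial_functions.const)
    then show "point_ideal x \<noteq> {}" by blast
    show "\<ominus>\<^bsub>C\<^esub> f \<in> point_ideal x" if "f \<in> point_ideal x" for f
      using that by (auto simp: point_ideal_def C_minus intro!: imageI binomial_functions_minus)
    fix f g assume "f \<in> point_ideal x" "g \<in> point_ideal x"
    then obtain \<phi> \<psi> where \<phi>: "\<phi> \<in> F" "f = diag \<phi>" "\<forall>\<^sub>F n in sequentially. int p dvd \<phi> (nat (x n))"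
      and \<psi>: "\<psi> \<in> F" "g = diag \<psi>" "\<forall>\<^sub>F n in sequentially. int p dvd \<psi> (nat (x n))"
      by (auto simp: point_ideal_def)
    from \<phi>(3) \<psi>(3) have "\<forall>\<^sub>F n in sequentially. int p dvd \<phi> (nat (x n)) + \<psi> (nat (x n))"
      by eventually_elim (rule dvd_add)
    then show "f \<oplus>\<^bsub>C\<^esub> g \<in> point_ideal x"
      using \<phi> \<psi> by (auto simp: point_ideal_def C_ops intro!: imageI binomial_functions.add)
  qed
  show l: "g \<otimes>\<^bsub>C\<^esub> f \<in> point_ideal x" if "f \<in> point_ideal x" "g \<in> carrier C" for f g
  proof -
    obtain \<phi> \<psi> where \<phi>: "\<phi> \<in> F" "f = diag \<phi>" "\<forall>\<^sub>F n in sequentially. int p dvd \<phi> (nat (x n))"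
      and \<psi>: "\<psi> \<in> F" "g = diag \<psi>"
      using \<open>f \<in> point_ideal x\<close> \<open>g \<in> carrier C\<close> by (auto simp: point_ideal_def carrier_C)
    from \<phi>(3) have "\<forall>\<^sub>F n in sequentially. int p dvd \<psi> (nat (x n)) * \<phi> (nat (x n))"
      by eventually_elim (rule dvd_mult)
    then show ?thesis
      using \<phi> \<psi> by (auto simp: point_ideal_def C_ops intro!: imageI binomial_functions.mult)
  qed
  show "f \<otimes>\<^bsub>C\<^esub> g \<in> point_ideal x" if "f \<in> point_ideal x" "g \<in> carrier C" for f g
    using l[OF that] C.m_comm[of f g] that by (auto simp: point_ideal_def carrier_C)
  have "diag (\<lambda>a. 1) \<notin> point_ideal x"
    using diag_in_point_ideal_iff[OF x binomial_functions.const[of 1], of 0] p_gt_1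
    by (simp add: periodic_mod_def)
  then show "carrier C \<noteq> point_ideal x"
    using diag_in_C[OF binomial_functions.const[of 1]] by blast
  fix f g assume "f \<in> carrier C" "g \<in> carrier C" and fg: "f \<otimes>\<^bsub>C\<^esub> g \<in> point_ideal x"
  then obtain \<phi> \<psi> where \<phi>: "\<phi> \<in> F" "f = diag \<phi>" and \<psi>: "\<psi> \<in> F" "g = diag \<psi>"
    by (auto simp: carrier_C)
  obtain N where N: "periodic_mod p N \<phi>" "periodic_mod p N \<psi>"
    by (rule periodic_mod_common[OF binomial_functions_periodic[OF prime_p \<phi>(1)]
          binomial_functions_periodic[OF prime_p \<psi>(1)]])
  then have "periodic_mod p N (\<lambda>a. \<phi> a * \<psi> a)"
    by (simp add: periodic_mod_def cong_mult)
  with fg have "int p dvd \<phi> (nat (x N)) * \<psi> (nat (x N))"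
    using diag_in_point_ideal_iff[OF x binomial_functions.mult[OF \<phi>(1) \<psi>(1)]] \<phi> \<psi> by (simp add: C_ops)
  then have "int p dvd \<phi> (nat (x N)) \<or> int p dvd \<psi> (nat (x N))"
    using prime_p by (simp add: prime_dvd_mult_iff)
  then show "f \<in> point_ideal x \<or> g \<in> point_ideal x"
    using diag_in_point_ideal_iff[OF x \<phi>(1)] diag_in_point_ideal_iff[OF x \<psi>(1)] N \<phi> \<psi> by blast
qed (rule cring_C)

text \<open>The residues that the prime ideal selects are the approximations of the required point \<open>x\<close>. By
  \<open>prime_contains_iff\<close> and \<open>diag_in_point_ideal_iff\<close>, both ideals consist of the \<open>\<phi>\<close> that vanish modulo
  \<open>p\<close> at a sufficiently good approximation.\<close>

lemma prime_is_point_ideal: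
  assumes P: "primeideal P C"
  shows "\<exists>x\<in>carrier Z. point_ideal x = P"
proof -
  obtain r where r: "\<And>n. r n < p ^ n" "\<And>n. diag (indicator_fun n (r n)) \<notin> P"
    using prime_selects_residue[OF P] by metis
  define x where "x n = int (r n)" for n
  have "x (Suc n) mod int p ^ n = x n" for n
    using prime_selects_compatible_residues[OF P r(2) r(2), of n "Suc n"] r(1)[of n]
    by (simp add: x_def flip: of_nat_power of_nat_mod)
  moreover have "x n < int p ^ n" for n
    using r(1)[of n] by (simp add: x_def flip: of_nat_power)
  ultimately have x: "x \<in> carrier Z" by (simp add: padic_ints_def x_def)
  have "diag \<phi> \<in> point_ideal x \<longleftrightarrow> diag \<phi> \<in> P" if "\<phi> \<in> F" for \<phi>
  proof -
    obtain N where N: "periodic_mod p N \<phi>"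
      using binomial_functions_periodic[OF prime_p \<open>\<phi> \<in> F\<close>] by blast
    show ?thesis
      using diag_in_point_ideal_iff[OF x that N] prime_contains_iff[OF P that N r(2)]
      by (simp add: x_def)
  qed
  moreover have "P \<subseteq> diag ` F"
    using ideal.Icarr[OF prime_ideal[OF P]] by (auto simp: carrier_C)
  moreover have "point_ideal x \<subseteq> diag ` F" by (auto simp: point_ideal_def)
  ultimately have "point_ideal x = P" by blast
  with x show ?thesis by blast
qed

text \<open>Distinct points are separated by the indicator of a residue class.\<close>

lemma inj_on_point_ideal: "inj_on point_ideal (carrier Z)"
proof (rule inj_onI, rule ext)
  fix x y n assume x: "x \<in> carrier Z" and y: "y \<in> carrier Z" and eq: "point_ideal x = point_ideal y"
  have "nat (x n) = nat (y n)"
    using indicator_in_point_ideal_iff[OF x, of n "nat (x n)"] indicator_in_point_ideal_iff[OF y, of n "nat (x n)"]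
      padic_nat(2)[OF x, of n] eq by simp
  then show "x n = y n" using padic_nat(1)[OF x] padic_nat(1)[OF y] by metis
qed

lemma bij_betw_point_ideal: "bij_betw point_ideal (carrier Z) {P. primeideal P C}"
  using inj_on_point_ideal prime_is_point_ideal primeideal_point_ideal
  unfolding bij_betw_def by blast

section \<open>The homeomorphism\<close>

lemma padic_topology_eq:
  "padic_topology p = topology_generated_by {{y \<in> carrier Z. y n = x n} | n x. x \<in> carrier Z}"
proof -
  have "{(PIdl\<^bsub>Z\<^esub> ([(p ^ n)] \<cdot>\<^bsub>Z\<^esub> \<one>\<^bsub>Z\<^esub>)) +>\<^bsub>Z\<^esub> x | n x. x \<in> carrier Z}
      = {{y \<in> carrier Z. y n = x n} | n x. x \<in> carrier Z}"
    using padic_coset_eq[OF p_pos] by (metis (no_types, lifting))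
  then show ?thesis by (simp add: padic_topology_def Let_def)
qed

lemma topspace_padic: "topspace (padic_topology p) = carrier Z"
  unfolding padic_topology_eq by auto

lemma openin_padic_coset: "x \<in> carrier Z \<Longrightarrow> openin (padic_topology p) {y \<in> carrier Z. y n = x n}"
  unfolding padic_topology_eq by (rule topology_generated_by_Basis) blast

text \<open>The preimage of a Zariski open set consists of the \<open>x\<close> at which some \<open>\<phi>\<close> of a given set is nonzero
  modulo \<open>p\<close>, which is open because \<open>\<phi>\<close> is locally constant.\<close>

lemma continuous_point_ideal:
  "continuous_map (padic_topology p) (Spec_topology C) point_ideal"
  unfolding continuous_map_def topspace_padic topspace_Spec_topology
proof (intro conjI allI impI)
  show "point_ideal \<in> carrier Z \<rightarrow> {P. primeideal P C}"
    using primeideal_point_ideal by blast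
  fix U assume "openin (Spec_topology C) U"
  then obtain S where S: "S \<subseteq> carrier C" "U = {P. primeideal P C} - {P. primeideal P C \<and> S \<subseteq> P}"
    unfolding openin_Spec_topology by blast
  have U: "point_ideal y \<in> U \<longleftrightarrow> \<not> S \<subseteq> point_ideal y" if "y \<in> carrier Z" for y
    using primeideal_point_ideal[OF that] by (simp add: S(2))
  show "openin (padic_topology p) {x \<in> carrier Z. point_ideal x \<in> U}"
  proof (subst openin_subopen, intro ballI)
    fix x assume "x \<in> {x \<in> carrier Z. point_ideal x \<in> U}"
    then have x: "x \<in> carrier Z" "\<not> S \<subseteq> point_ideal x" using U by auto
    then obtain \<phi> where \<phi>: "\<phi> \<in> F" "diag \<phi> \<in> S" "diag \<phi> \<notin> point_ideal x"
      using S(1) by (auto simp: carrier_C)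
    obtain N where N: "periodic_mod p N \<phi>"
      using binomial_functions_periodic[OF prime_p \<phi>(1)] by blast
    have "point_ideal y \<in> U" if y: "y \<in> carrier Z" "y N = x N" for y
    proof -
      have "diag \<phi> \<notin> point_ideal y"
        using \<phi>(3) y(2) diag_in_point_ideal_iff[OF x(1) \<phi>(1) N]
          diag_in_point_ideal_iff[OF y(1) \<phi>(1) N] by simp
      then show ?thesis using U[OF y(1)] \<phi>(2) by blast
    qed
    then have "{y \<in> carrier Z. y N = x N} \<subseteq> {x \<in> carrier Z. point_ideal x \<in> U}" by blast
    then show "\<exists>T. openin (padic_topology p) T \<and> x \<in> T \<and> T \<subseteq> {x \<in> carrier Z. point_ideal x \<in> U}"
      using openin_padic_coset[OF x(1), of N] x(1) by blast
  qed
qed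

text \<open>A coset of \<open>p\<^sup>n \<int>\<^sub>p\<close> corresponds to the basic Zariski open set on which its indicator does not vanish.\<close>

lemma continuous_inv_point_ideal:
  "continuous_map (Spec_topology C) (padic_topology p) (inv_into (carrier Z) point_ideal)"
  unfolding padic_topology_eq continuous_on_generated_topo_iff topspace_Spec_topology
proof (intro conjI allI impI)
  let ?g = "inv_into (carrier Z) point_ideal"
  have g: "?g P \<in> carrier Z" "point_ideal (?g P) = P" if "primeideal P C" for P
    using that bij_betw_point_ideal unfolding bij_betw_def
    by (metis inv_into_into mem_Collect_eq, metis f_inv_into_f mem_Collect_eq)
  show "?g ` {P. primeideal P C} \<subseteq> \<Union> {{y \<in> carrier Z. y n = x n} | n x. x \<in> carrier Z}"
    using g(1) by auto
  fix T assume "T \<in> {{y \<in> carrier Z. y n = x n} | n x. x \<in> carrier Z}"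
  then obtain n x where x: "x \<in> carrier Z" and T: "T = {y \<in> carrier Z. y n = x n}" by blast
  let ?e = "diag (indicator_fun n (nat (x n)))"
  have "?g P \<in> T \<longleftrightarrow> ?e \<notin> P" if "primeideal P C" for P
  proof -
    have "?e \<notin> point_ideal (?g P) \<longleftrightarrow> nat (?g P n) = nat (x n)"
      using indicator_in_point_ideal_iff[OF g(1)[OF that]] padic_nat(2)[OF x, of n] by simp
    also have "\<dots> \<longleftrightarrow> ?g P n = x n"
      using padic_nat(1)[OF x] padic_nat(1)[OF g(1)[OF that]] by metis
    finally show ?thesis using g[OF that] by (simp add: T)
  qed
  then have "?g -` T \<inter> {P. primeideal P C} = {P. primeideal P C} - {P. primeideal P C \<and> {?e} \<subseteq> P}"
    by auto
  then show "openin (Spec_topology C) (?g -` T \<inter> {P. primeideal P C})"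
    unfolding openin_Spec_topology using diag_in_C[OF indicator_fun(1)]
    by (intro exI[of _ "{?e}"]) simp
qed

lemma Spec_homeomorphic_padic: "Spec_topology C homeomorphic_space padic_topology p"
proof -
  have "homeomorphic_maps (padic_topology p) (Spec_topology C) point_ideal (inv_into (carrier Z) point_ideal)"
    unfolding homeomorphic_maps_def topspace_padic topspace_Spec_topology
    using continuous_point_ideal continuous_inv_point_ideal bij_betw_point_ideal
    by (auto simp: bij_betw_def inv_into_f_f f_inv_into_f)
  then show ?thesis
    using homeomorphic_space_def homeomorphic_space_sym by blast
qed

end

theorem proposition1p1:
  fixes p m :: nat
  assumes "prime p"
  shows "cring (C_alg p m) \<and>
    (\<forall>P. primeideal P (C_alg p m) \<longrightarrow> maximalideal P (C_alg p m)) \<and>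
    Spec_topology (C_alg p m) homeomorphic_space padic_topology p"
proof -
  interpret prime_power_algebra p m by unfold_locales (rule assms)
  show ?thesis
    using cring_C prime_imp_maximal Spec_homeomorphic_padic by blast
qed

end
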